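(* Consider the single-cell uplink with aged CSI and MRC receivers described in the context, with $K$, $\tau$, $\alpha$ and $\beta_1,\dots,\beta_K$ fixed, and fix $E_u>0$. Each user can scale down its transmit power at most by $p_u=E_u/\sqrt M$, in the following sense: for every $k\in\{1,\dots,K\}$, if $p_u=E_u/\sqrt M$ then $$R_k^{\mathrm{a,mrc}}\longrightarrow\log_2\left(1+\alpha^2\tau E_u^2\beta_k^2\right)\qquad(M\to\infty),$$ whereas if $p_u=E_u/M^\gamma$ with $\gamma>\frac12$ then $R_k^{\mathrm{a,mrc}}\to0$ as $M\to\infty$.
   Context: System: a base station (BS) with $M$ antennas and $K\le M$ single-antenna users; $p_u>0$ is the transmit power per user, $\tau\ge K$ the (integer) training length, $p_p:=\tau p_u$, and $\beta_1,\dots,\beta_K>0$ are constants (large-scale fading). The channel vector of user $k$ at time $n$ is $\mathbf g_k[n]\in\mathbb C^M$ with i.i.d. $\mathcal{CN}(0,\beta_k)$ entries, independent across users. Estimation: the BS observes $\tilde{\mathbf y}_k[n]=\mathbf g_k[n]+\frac{1}{\sqrt{p_p}}\mathbf b_k[n]$, where the $\mathbf b_k[n]$ have i.i.d. $\mathcal{CN}(0,1)$ entries, are independent across $k$ and independent of the channels. The MMSE estimate is $\hat{\mathbf g}_k[n]=\frac{p_p\beta_k}{1+p_p\beta_k}\tilde{\mathbf y}_k[n]$; its entries are i.i.d. $\mathcal{CN}\left(0,\frac{p_p\beta_k^2}{1+p_p\beta_k}\right)$, independent across $k$. Aging: $\mathbf g_k[n+1]=\alpha\mathbf g_k[n]+\mathbf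 e_k[n+1]$, where $\alpha$ is real with $0\le|\alpha|\le1$ and $\mathbf e_k[n+1]$ is independent of the foregoing with i.i.d. $\mathcal{CN}(0,(1-\alpha^2)\beta_k)$ entries. The BS uses the aged CSI $\bar{\mathbf g}_k[n+1]=\alpha\hat{\mathbf g}_k[n]$. Rate: with linear detector vector $\hat{\mathbf a}_k$ for user $k$, the achievable rate of user $k$ is defined as $$R_k=\mathrm E\left\{\log_2\left(1+\frac{p_u|\hat{\mathbf a}_k^\dagger\bar{\mathbf g}_k|^2}{p_u\sum_{i\ne k}|\hat{\mathbf a}_k^\dagger\bar{\mathbf g}_i|^2+\|\hat{\mathbf a}_k\|^2\left(p_u\sum_{i=1}^K\left(\beta_i-\alpha^2\frac{p_p\beta_i^2}{1+p_p\beta_i}\right)+1\right)}\right)\right\},$$ where $\bar{\mathbf g}_i=\bar{\mathbf g}_i[n+1]$, $^\dagger$ is conjugate transpose, and the fraction is read as $0$ when $\hat{\mathbf a}_k=0$. The MRC receiver is $\hat{\mathbf a}_k=\bar{\mathbf g}_k[n+1]$, and the resulting $R_k$ is denoted $R_k^{\mathrm{a,mrc}}$. *)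

theory Defs
  imports "HOL-Probability.Probability"
begin

text \<open>
  Vectors in \<open>\<complex>\<^sup>M\<close> are functions \<open>nat \<Rightarrow> complex\<close> of which only the entries \<open>j < M\<close> matter; a
  random vector is a function \<open>\<omega> \<mapsto> (j \<mapsto> entry)\<close>.  Users are numbered \<open>1, \<dots>, K\<close>.
\<close>

definition cdot :: "nat \<Rightarrow> (nat \<Rightarrow> complex) \<Rightarrow> (nat \<Rightarrow> complex) \<Rightarrow> complex" where
  "cdot M x y = (\<Sum>j<M. cnj (x j) * y j)"

definition cnorm :: "nat \<Rightarrow> (nat \<Rightarrow> complex) \<Rightarrow> real" where
  "cnorm M x = L2_set (\<lambda>j. cmod (x j)) {..<M}"

text \<open>
  The variance \<open>v = 0\<close> has to be treated separately, since \<^const>\<open>normal_density\<close> with standard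
  deviation \<open>0\<close> is the zero function.  It occurs for the innovations when \<open>\<bar>\<alpha>\<bar> = 1\<close>.
\<close>

definition centred_normal :: "real \<Rightarrow> real measure" where
  "centred_normal v =
     (if v = 0 then return borel 0 else density lborel (\<lambda>x. ennreal (normal_density 0 (sqrt v) x)))"

text \<open>\<open>\<C>\<N>(0,v)\<close>: real and imaginary part are independent, each with distribution \<open>\<N>(0,v/2)\<close>.\<close>

definition complex_normal :: "real \<Rightarrow> complex measure" where
  "complex_normal v =
     distr (centred_normal (v / 2) \<Otimes>\<^sub>M centred_normal (v / 2)) borel (\<lambda>(x, y). Complex x y)"

datatype source = Channel | Noise | Innovation

fun source_var :: "(nat \<Rightarrow> 'a \<Rightarrow> nat \<Rightarrow> complex) \<Rightarrow> (nat \<Rightarrow> 'a \<Rightarrow> nat \<Rightarrow> complex) \<Rightarrow>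
    (nat \<Rightarrow> 'a \<Rightarrow> nat \<Rightarrow> complex) \<Rightarrow> source \<times> nat \<times> nat \<Rightarrow> 'a \<Rightarrow> complex" where
  "source_var g b e (Channel, k, j) = (\<lambda>\<omega>. g k \<omega> j)"
| "source_var g b e (Noise, k, j) = (\<lambda>\<omega>. b k \<omega> j)"
| "source_var g b e (Innovation, k, j) = (\<lambda>\<omega>. e k \<omega> j)"

text \<open>
  \<open>g k\<close> is the channel of user \<open>k\<close> at time \<open>n\<close>, \<open>g_next k\<close> the one at time \<open>n + 1\<close>, \<open>b k\<close> the
  estimation noise at time \<open>n\<close> and \<open>e k\<close> the innovation at time \<open>n + 1\<close>.
\<close>

locale aged_uplink = prob_space P
  for P :: "'a measure" +
  fixes M K :: nat
    and \<beta> :: "nat \<Rightarrow> real"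
    and \<alpha> :: real
    and g b e g_next :: "nat \<Rightarrow> 'a \<Rightarrow> nat \<Rightarrow> complex"
  assumes indep: "indep_vars (\<lambda>_. borel) (source_var g b e) (UNIV \<times> {1..K} \<times> {..<M})"
    and channel: "\<And>k j. k \<in> {1..K} \<Longrightarrow> j < M \<Longrightarrow>
      distr P borel (\<lambda>\<omega>. g k \<omega> j) = complex_normal (\<beta> k)"
    and noise: "\<And>k j. k \<in> {1..K} \<Longrightarrow> j < M \<Longrightarrow>
      distr P borel (\<lambda>\<omega>. b k \<omega> j) = complex_normal 1"
    and innovation: "\<And>k j. k \<in> {1..K} \<Longrightarrow> j < M \<Longrightarrow>
      distr P borel (\<lambda>\<omega>. e k \<omega> j) = complex_normal ((1 - \<alpha>\<^sup>2) * \<beta> k)"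
    and aging: "\<And>k j \<omega>. k \<in> {1..K} \<Longrightarrow> j < M \<Longrightarrow> \<omega> \<in> space P \<Longrightarrow>
      g_next k \<omega> j = complex_of_real \<alpha> * g k \<omega> j + e k \<omega> j"

definition pilot_power :: "nat \<Rightarrow> real \<Rightarrow> real" where
  "pilot_power \<tau> pu = real \<tau> * pu"

definition observation :: "real \<Rightarrow> (nat \<Rightarrow> 'a \<Rightarrow> nat \<Rightarrow> complex) \<Rightarrow>
    (nat \<Rightarrow> 'a \<Rightarrow> nat \<Rightarrow> complex) \<Rightarrow> nat \<Rightarrow> 'a \<Rightarrow> nat \<Rightarrow> complex" where
  "observation pp g b k \<omega> j = g k \<omega> j + complex_of_real (1 / sqrt pp) * b k \<omega> j"

definition mmse_estimate :: "real \<Rightarrow> (nat \<Rightarrow> real) \<Rightarrow> (nat \<Rightarrow> 'a \<Rightarrow> nat \<Rightarrow> complex) \<Rightarrow>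
    (nat \<Rightarrow> 'a \<Rightarrow> nat \<Rightarrow> complex) \<Rightarrow> nat \<Rightarrow> 'a \<Rightarrow> nat \<Rightarrow> complex" where
  "mmse_estimate pp \<beta> g b k \<omega> j =
     complex_of_real (pp * \<beta> k / (1 + pp * \<beta> k)) * observation pp g b k \<omega> j"

definition aged_csi :: "real \<Rightarrow> real \<Rightarrow> (nat \<Rightarrow> real) \<Rightarrow> (nat \<Rightarrow> 'a \<Rightarrow> nat \<Rightarrow> complex) \<Rightarrow>
    (nat \<Rightarrow> 'a \<Rightarrow> nat \<Rightarrow> complex) \<Rightarrow> nat \<Rightarrow> 'a \<Rightarrow> nat \<Rightarrow> complex" where
  "aged_csi \<alpha> pp \<beta> g b k \<omega> j = complex_of_real \<alpha> * mmse_estimate pp \<beta> g b k \<omega> j"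

text \<open>
  \<open>a\<close> is the detector of user \<open>k\<close> and \<open>h i\<close> the aged CSI of user \<open>i\<close>.  If \<open>a\<close> vanishes, numerator
  and denominator are both \<open>0\<close>, and \<open>0 / 0 = 0\<close> is the intended value of the fraction.
\<close>

definition sinr :: "nat \<Rightarrow> nat \<Rightarrow> real \<Rightarrow> real \<Rightarrow> (nat \<Rightarrow> real) \<Rightarrow> real \<Rightarrow> (nat \<Rightarrow> complex) \<Rightarrow>
    (nat \<Rightarrow> nat \<Rightarrow> complex) \<Rightarrow> nat \<Rightarrow> real" where
  "sinr M K \<alpha> pp \<beta> pu a h k =
     pu * (cmod (cdot M a (h k)))\<^sup>2 /
     (pu * (\<Sum>i\<in>{1..K} - {k}. (cmod (cdot M a (h i)))\<^sup>2) +
      (cnorm M a)\<^sup>2 *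
        (pu * (\<Sum>i=1..K. \<beta> i - \<alpha>\<^sup>2 * (pp * (\<beta> i)\<^sup>2 / (1 + pp * \<beta> i))) + 1))"

definition rate :: "'a measure \<Rightarrow> nat \<Rightarrow> nat \<Rightarrow> nat \<Rightarrow> real \<Rightarrow> (nat \<Rightarrow> real) \<Rightarrow>
    (nat \<Rightarrow> 'a \<Rightarrow> nat \<Rightarrow> complex) \<Rightarrow> (nat \<Rightarrow> 'a \<Rightarrow> nat \<Rightarrow> complex) \<Rightarrow> real \<Rightarrow>
    ('a \<Rightarrow> nat \<Rightarrow> complex) \<Rightarrow> nat \<Rightarrow> real" where
  "rate P M K \<tau> \<alpha> \<beta> g b pu a k =
     (let pp = pilot_power \<tau> pu in
       \<integral>\<omega>. log 2 (1 + sinr M K \<alpha> pp \<beta> pu (a \<omega>) (\<lambda>i. aged_csi \<alpha> pp \<beta> g b i \<omega>) k) \<partial>P)"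

definition rate_mrc :: "'a measure \<Rightarrow> nat \<Rightarrow> nat \<Rightarrow> nat \<Rightarrow> real \<Rightarrow> (nat \<Rightarrow> real) \<Rightarrow>
    (nat \<Rightarrow> 'a \<Rightarrow> nat \<Rightarrow> complex) \<Rightarrow> (nat \<Rightarrow> 'a \<Rightarrow> nat \<Rightarrow> complex) \<Rightarrow> real \<Rightarrow> nat \<Rightarrow> real" where
  "rate_mrc P M K \<tau> \<alpha> \<beta> g b pu k =
     rate P M K \<tau> \<alpha> \<beta> g b pu (aged_csi \<alpha> (pilot_power \<tau> pu) \<beta> g b k) k"

end

theory Submission
  imports Defs "HOL-Real_Asymp.Real_Asymp"
begin

text \<open>
  Write \<open>p\<close> for the transmit power, \<open>X = \<parallel>h\<^sub>k\<parallel>\<^sup>2\<close> for the energy of the aged CSI of user \<open>k\<close>, \<open>I\<close> for the sum of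
  \<open>\<bar>h\<^sub>k\<^sup>\<dagger> h\<^sub>i\<bar>\<^sup>2\<close> over \<open>i \<noteq> k\<close>, and \<open>S\<close> for the total estimation error variance.  Since
  \<open>X\<^sup>2 / D \<ge> 2 X - D\<close> for the denominator \<open>D = p I + X (p S + 1) \<ge> X\<close>, the SINR lies between
  \<open>p X - p\<^sup>2 (S X + I)\<close> and \<open>p X\<close>.  As \<open>s \<mapsto> log 2 (1 + s)\<close> is Lipschitz for \<open>s \<ge> 0\<close>, the rate differs from
  \<open>log 2 (1 + p E X)\<close> by at most a constant times \<open>p E \<bar>X - E X\<bar> + p\<^sup>2 (S E X + E I)\<close>.  Independence across
  antennas makes \<open>E \<bar>X - E X\<bar>\<close> of order \<open>p sqrt M\<close> and, together with independence across users,
  \<open>E I\<close> of order \<open>p\<^sup>2 M\<close>; so the error vanishes as soon as \<open>p \<rightarrow> 0\<close> and \<open>p\<^sup>2 M\<close> converges, while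
  \<open>p E X\<close> is asymptotically \<open>\<alpha>\<^sup>2 \<tau> \<beta>\<^sub>k\<^sup>2 p\<^sup>2 M\<close>.
\<close>

subsection \<open>Moments of complex normal variables and independent sums\<close>

lemma centred_normal_moments:
  assumes "0 < v"
  shows "prob_space (centred_normal v)"
    and "sets (centred_normal v) = sets borel"
    and "integrable (centred_normal v) (\<lambda>x. x ^ k)"
    and "(\<integral>x. x \<partial>centred_normal v) = 0"
    and "(\<integral>x. x\<^sup>2 \<partial>centred_normal v) = v"
proof -
  have eq: "centred_normal v = density lborel (\<lambda>x. ennreal (normal_density 0 (sqrt v) x))"
    using assms by (simp add: centred_normal_def)
  have s: "0 < sqrt v" using assms by simp
  show "prob_space (centred_normal v)"
    unfolding eq using s by (rule prob_space_normal_density)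
  show "sets (centred_normal v) = sets borel" by (simp add: eq)
  show "integrable (centred_normal v) (\<lambda>x. x ^ k)"
    unfolding eq using integrable_normal_moment[OF s, of 0 k]
    by (subst integrable_density) (auto simp: normal_density_nonneg)
  show "(\<integral>x. x \<partial>centred_normal v) = 0"
    unfolding eq using integral_normal_moment_nz_1[OF s, of 0]
    by (subst integral_density) (auto simp: normal_density_nonneg)
  show "(\<integral>x. x\<^sup>2 \<partial>centred_normal v) = v"
    unfolding eq using integral_normal_moment_even[OF s, of 0 1] assms
    by (subst integral_density) (auto simp: normal_density_nonneg)
qed

lemma distr_pair_snd:
  assumes "prob_space M" "prob_space N"
  shows "distr (M \<Otimes>\<^sub>M N) N snd = N"
proof -
  interpret M: prob_space M by fact
  interpret N: prob_space N by fact
  interpret pair_sigma_finite M N ..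
  have "distr (M \<Otimes>\<^sub>M N) N snd = distr (distr (N \<Otimes>\<^sub>M M) (M \<Otimes>\<^sub>M N) (\<lambda>(x, y). (y, x))) N snd"
    by (subst distr_pair_swap) simp
  also have "\<dots> = distr (N \<Otimes>\<^sub>M M) N fst"
    by (subst distr_distr) (auto simp: comp_def split_beta)
  finally show ?thesis by (simp add: M.distr_pair_fst)
qed

lemma borel_measurable_Complex [measurable]:
  "f \<in> borel_measurable M \<Longrightarrow> g \<in> borel_measurable M \<Longrightarrow> (\<lambda>x. Complex (f x) (g x)) \<in> borel_measurable M"
  by (simp add: borel_measurable_complex_iff)

lemma borel_measurable_cnj [measurable]: "cnj \<in> borel_measurable borel"
  by (intro borel_measurable_continuous_onI continuous_intros)

text \<open>Everything reduces to powers of the real and the imaginary part, whose laws are the two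
  marginals of the product. Each part contributes \<open>v / 2\<close> to the second absolute
  moment; the fourth only has to be finite, so a crude bound suffices.\<close>

lemma complex_normal_moments:
  assumes "0 < v"
  shows "integrable (complex_normal v) (\<lambda>z. z)"
    and "(\<integral>z. z \<partial>complex_normal v) = 0"
    and "(\<integral>z. (cmod z)\<^sup>2 \<partial>complex_normal v) = v"
    and "integrable (complex_normal v) (\<lambda>z. cmod z ^ 4)"
proof -
  define N where "N = centred_normal (v / 2)"
  have v: "0 < v / 2" using assms by simp
  note mom = centred_normal_moments[OF v, folded N_def]
  interpret N: prob_space N by (rule mom)
  note [measurable_cong, simp] = mom(2)
  interpret NN: pair_prob_space N N ..
  have cn: "complex_normal v = distr (N \<Otimes>\<^sub>M N) borel (\<lambda>z. Complex (fst z) (snd z))"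
    by (simp add: complex_normal_def N_def case_prod_beta')
  have meas [measurable]: "(\<lambda>z. Complex (fst z) (snd z)) \<in> borel_measurable (N \<Otimes>\<^sub>M N)"
    by measurable
  have fst_m: "distr (N \<Otimes>\<^sub>M N) N fst = N" by (rule N.distr_pair_fst)
  have snd_m: "distr (N \<Otimes>\<^sub>M N) N snd = N" by (rule distr_pair_snd) (rule mom)+
  have fst_int: "integrable (N \<Otimes>\<^sub>M N) (\<lambda>z. fst z ^ k)" for k
    using mom(3)[of k] by (subst (asm) fst_m[symmetric], subst (asm) integrable_distr_eq) auto
  have snd_int: "integrable (N \<Otimes>\<^sub>M N) (\<lambda>z. snd z ^ k)" for k
    using mom(3)[of k] by (subst (asm) snd_m[symmetric], subst (asm) integrable_distr_eq) auto
  have fst_eq: "(\<integral>z. fst z ^ k \<partial>(N \<Otimes>\<^sub>M N)) = (\<integral>x. x ^ k \<partial>N)" for k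
    by (subst (2) fst_m[symmetric], subst integral_distr) auto
  have snd_eq: "(\<integral>z. snd z ^ k \<partial>(N \<Otimes>\<^sub>M N)) = (\<integral>x. x ^ k \<partial>N)" for k
    by (subst (2) snd_m[symmetric], subst integral_distr) auto
  have c1: "integrable (N \<Otimes>\<^sub>M N) (\<lambda>z. complex_of_real (fst z) + \<i> * complex_of_real (snd z))"
    using fst_int[of 1] snd_int[of 1] by auto
  then show "integrable (complex_normal v) (\<lambda>z. z)"
    unfolding cn by (subst integrable_distr_eq) (auto simp: Complex_eq)
  show "(\<integral>z. z \<partial>complex_normal v) = 0"
    unfolding cn using fst_int[of 1] snd_int[of 1] fst_eq[of 1] snd_eq[of 1] mom(4)
    by (subst integral_distr) (auto simp: Complex_eq)
  show "(\<integral>z. (cmod z)\<^sup>2 \<partial>complex_normal v) = v"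
    unfolding cn using fst_int[of 2] snd_int[of 2] fst_eq[of 2] snd_eq[of 2] mom(5)
    by (subst integral_distr) (auto simp: cmod_power2)
  \<comment> \<open>Convexity of the square, applied to \<open>x\<^sup>2\<close> and
    \<open>y\<^sup>2\<close>.\<close>
  have bd: "cmod (Complex x y) ^ 4 \<le> 2 * (x ^ 4 + y ^ 4)" for x y
  proof -
    have "cmod (Complex x y) ^ 4 = ((cmod (Complex x y))\<^sup>2)\<^sup>2"
      by (simp flip: power_mult)
    also have "\<dots> = (x\<^sup>2 + y\<^sup>2)\<^sup>2" by (simp add: cmod_power2)
    also have "\<dots> \<le> 2 * ((x\<^sup>2)\<^sup>2 + (y\<^sup>2)\<^sup>2)"
      by (smt (verit) power2_diff power2_sum zero_le_power2)
    finally show ?thesis by (simp flip: power_mult)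
  qed
  have "integrable (N \<Otimes>\<^sub>M N) (\<lambda>z. cmod (Complex (fst z) (snd z)) ^ 4)"
  proof (rule Bochner_Integration.integrable_bound)
    show "integrable (N \<Otimes>\<^sub>M N) (\<lambda>z. 2 * (fst z ^ 4 + snd z ^ 4))"
      using fst_int[of 4] snd_int[of 4] by auto
  qed (auto intro!: AE_I2 order.trans[OF bd])
  then show "integrable (complex_normal v) (\<lambda>z. cmod z ^ 4)"
    unfolding cn by (subst integrable_distr_eq) auto
qed

section \<open>Independence of blocks and second moments of independent sums\<close>

context prob_space
begin

text \<open>Restricting an independent family to disjoint index blocks gives independent random
  vectors, and measurable functions of these stay independent. Independence claims about
  observations come from a choice of blocks \<open>L\<close> and block functions
  \<open>F\<close>.\<close>

lemma indep_vars_blocks: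
  assumes "indep_vars (\<lambda>_. borel) X I"
    and "\<And>j. j \<in> J \<Longrightarrow> L j \<subseteq> I" "disjoint_family_on L J"
    and "\<And>j. j \<in> J \<Longrightarrow> F j \<in> borel_measurable (\<Pi>\<^sub>M i\<in>L j. borel)"
    and "\<And>j \<omega>. j \<in> J \<Longrightarrow> Y j \<omega> = F j (\<lambda>i\<in>L j. X i \<omega>)"
  shows "indep_vars (\<lambda>_. borel) Y J"
proof -
  have "indep_vars (\<lambda>_. borel) (\<lambda>j \<omega>. F j (\<lambda>i\<in>L j. X i \<omega>)) J"
    using indep_vars_restrict[OF assms(1-3)] assms(4) by (rule indep_vars_compose2)
  then show ?thesis
    by (rule indep_vars_cong[THEN iffD1, rotated -1]) (auto simp: assms(5) fun_eq_iff)
qed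

text \<open>Pythagoras in L2: after expanding the square, the mixed terms of independent centred
  variables vanish. A sum over n antennas thus has mean square of order n, not n^2.\<close>

lemma expectation_norm_sum_squared:
  fixes W :: "'i \<Rightarrow> 'a \<Rightarrow> complex"
  assumes "finite J" "indep_vars (\<lambda>_. borel) W J"
    and sq: "\<And>j. j \<in> J \<Longrightarrow> integrable M (\<lambda>\<omega>. (cmod (W j \<omega>))\<^sup>2)"
    and mean: "\<And>j. j \<in> J \<Longrightarrow> expectation (W j) = 0"
  shows "integrable M (\<lambda>\<omega>. (cmod (\<Sum>j\<in>J. W j \<omega>))\<^sup>2)"
    and "expectation (\<lambda>\<omega>. (cmod (\<Sum>j\<in>J. W j \<omega>))\<^sup>2) = (\<Sum>j\<in>J. expectation (\<lambda>\<omega>. (cmod (W j \<omega>))\<^sup>2))"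
proof -
  have rv [measurable]: "random_variable borel (W j)" if "j \<in> J" for j
    using assms(2) that by (auto simp: indep_vars_def)
  have int: "integrable M (W j)" if "j \<in> J" for j
  proof -
    have "integrable M (\<lambda>\<omega>. cmod (W j \<omega>))"
      by (rule square_integrable_imp_integrable) (use that sq in auto)
    then show ?thesis using integrable_norm_iff rv[OF that] by blast
  qed
  have cross: "integrable M (\<lambda>\<omega>. W i \<omega> * cnj (W j \<omega>)) \<and>
      expectation (\<lambda>\<omega>. W i \<omega> * cnj (W j \<omega>)) =
        (if i = j then complex_of_real (expectation (\<lambda>\<omega>. (cmod (W j \<omega>))\<^sup>2)) else 0)"
    if "i \<in> J" "j \<in> J" for i j
  proof (cases "i = j")
    case True
    then show ?thesis using sq[OF that(2)]
      by (simp add: complex_norm_square[symmetric] del: of_real_power)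
  next
    case False
    \<comment> \<open>Only one of the two factors is conjugated, hence a family over
      \<open>{i, j}\<close> whose form depends on the index. The expectation of the product then
      factorizes and is zero by \<open>mean\<close>.\<close>
    have "indep_vars (\<lambda>_. borel) (\<lambda>l \<omega>. if l = i then W l \<omega> else cnj (W l \<omega>)) {i, j}"
      by (rule indep_vars_compose2[where M'="\<lambda>_. borel" and Y="\<lambda>l z. if l = i then z else cnj z",
            OF indep_vars_subset[OF assms(2)]]) (use that in \<open>auto simp: borel_measurable_cnj\<close>)
    moreover have "integrable M (\<lambda>\<omega>. if l = i then W l \<omega> else cnj (W l \<omega>))" if "l \<in> {i, j}" for l
      using that \<open>i \<in> J\<close> \<open>j \<in> J\<close> int by (cases "l = i") auto
    ultimately show ?thesis
      using indep_vars_lebesgue_integral[of "{i, j}" "\<lambda>l \<omega>. if l = i then W l \<omega> else cnj (W l \<omega>)"]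
        indep_vars_integrable[of "{i, j}" "\<lambda>l \<omega>. if l = i then W l \<omega> else cnj (W l \<omega>)"]
        False that int mean by auto
  qed
  have expand: "complex_of_real ((cmod (\<Sum>j\<in>J. W j \<omega>))\<^sup>2) = (\<Sum>i\<in>J. \<Sum>j\<in>J. W i \<omega> * cnj (W j \<omega>))" for \<omega>
    by (simp only: complex_norm_square cnj_sum sum_product)
  have "integrable M (\<lambda>\<omega>. complex_of_real ((cmod (\<Sum>j\<in>J. W j \<omega>))\<^sup>2))"
    unfolding expand using cross by auto
  then show "integrable M (\<lambda>\<omega>. (cmod (\<Sum>j\<in>J. W j \<omega>))\<^sup>2)"
    by (subst (asm) complex_of_real_integrable_eq)
  have "complex_of_real (expectation (\<lambda>\<omega>. (cmod (\<Sum>j\<in>J. W j \<omega>))\<^sup>2))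
      = expectation (\<lambda>\<omega>. \<Sum>i\<in>J. \<Sum>j\<in>J. W i \<omega> * cnj (W j \<omega>))"
    by (simp only: integral_complex_of_real[symmetric] expand)
  also have "\<dots> = (\<Sum>i\<in>J. \<Sum>j\<in>J. expectation (\<lambda>\<omega>. W i \<omega> * cnj (W j \<omega>)))"
    using cross by (subst Bochner_Integration.integral_sum; auto intro!: sum.cong Bochner_Integration.integral_sum)
  also have "\<dots> = complex_of_real (\<Sum>j\<in>J. expectation (\<lambda>\<omega>. (cmod (W j \<omega>))\<^sup>2))"
    using cross assms(1) by simp
  finally show "expectation (\<lambda>\<omega>. (cmod (\<Sum>j\<in>J. W j \<omega>))\<^sup>2) = (\<Sum>j\<in>J. expectation (\<lambda>\<omega>. (cmod (W j \<omega>))\<^sup>2))"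
    by (simp only: of_real_eq_iff)
qed

text \<open>By Jensen, the mean absolute deviation is at most the root of the variance of the sum;
  variances of independent terms add, and each is at most the second moment of its term.\<close>

lemma expectation_abs_deviation_sum_le:
  fixes X :: "'i \<Rightarrow> 'a \<Rightarrow> real"
  assumes J: "finite J" "indep_vars (\<lambda>_. borel) X J"
    and sq: "\<And>j. j \<in> J \<Longrightarrow> integrable M (\<lambda>\<omega>. (X j \<omega>)\<^sup>2)"
    and bd: "\<And>j. j \<in> J \<Longrightarrow> expectation (\<lambda>\<omega>. (X j \<omega>)\<^sup>2) \<le> c"
  shows "integrable M (\<lambda>\<omega>. \<Sum>j\<in>J. X j \<omega>)"
    and "expectation (\<lambda>\<omega>. \<bar>(\<Sum>j\<in>J. X j \<omega>) - (\<Sum>j\<in>J. expectation (X j))\<bar>) \<le> sqrt (real (card J) * c)"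
proof -
  have rv [measurable]: "random_variable borel (X j)" if "j \<in> J" for j
    using assms(2) that by (auto simp: indep_vars_def)
  have int: "integrable M (X j)" if "j \<in> J" for j
    by (rule square_integrable_imp_integrable) (use that sq in auto)
  then show sum_int: "integrable M (\<lambda>\<omega>. \<Sum>j\<in>J. X j \<omega>)" by auto
  \<comment> \<open>Centred terms, embedded in the complex numbers so that
    \<open>expectation_norm_sum_squared\<close> applies.\<close>
  define W where "W = (\<lambda>j \<omega>. complex_of_real (X j \<omega> - expectation (X j)))"
  have W: "indep_vars (\<lambda>_. borel) W J"
    unfolding W_def by (rule indep_vars_compose2[OF J(2)]) auto
  have Wsq: "(cmod (W j \<omega>))\<^sup>2 = (X j \<omega> - expectation (X j))\<^sup>2" for j \<omega>
    by (simp add: W_def flip: of_real_diff)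
  have dev: "integrable M (\<lambda>\<omega>. (X j \<omega> - expectation (X j))\<^sup>2)" if "j \<in> J" for j
    using int[OF that] sq[OF that] by (simp add: power2_diff)
  have mean: "expectation (W j) = 0" if "j \<in> J" for j
    unfolding W_def using int[OF that] by (simp add: prob_space)
  define D where "D = (\<lambda>\<omega>. (\<Sum>j\<in>J. X j \<omega>) - (\<Sum>j\<in>J. expectation (X j)))"
  have sumW: "(cmod (\<Sum>j\<in>J. W j \<omega>))\<^sup>2 = (D \<omega>)\<^sup>2" for \<omega>
    by (simp add: W_def D_def sum_subtractf flip: of_real_sum of_real_diff)
  note E = expectation_norm_sum_squared[OF J(1) W _ mean, unfolded Wsq sumW, OF dev]
  have Dint: "integrable M D" unfolding D_def using sum_int by auto
  \<comment> \<open>Jensen's inequality, read off from the nonnegativity of the variance of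
    \<open>\<bar>D \<omega>\<bar>\<close>.\<close>
  have "(expectation (\<lambda>\<omega>. \<bar>D \<omega>\<bar>))\<^sup>2 \<le> expectation (\<lambda>\<omega>. (D \<omega>)\<^sup>2)"
    using variance_positive[of "\<lambda>\<omega>. \<bar>D \<omega>\<bar>"] Dint E(1) by (subst (asm) variance_eq) auto
  also have "\<dots> = (\<Sum>j\<in>J. variance (X j))" using E(2) by simp
  also have "\<dots> \<le> (\<Sum>j\<in>J. c)"
  proof (rule sum_mono)
    fix j assume j: "j \<in> J"
    have "variance (X j) \<le> expectation (\<lambda>\<omega>. (X j \<omega>)\<^sup>2)"
      using variance_eq[OF int[OF j] sq[OF j]] by simp
    then show "variance (X j) \<le> c" using bd[OF j] by linarith
  qed
  finally show "expectation (\<lambda>\<omega>. \<bar>(\<Sum>j\<in>J. X j \<omega>) - (\<Sum>j\<in>J. expectation (X j))\<bar>) \<le> sqrt (real (card J) * c)"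
    by (auto simp: D_def intro: real_le_rsqrt)
qed

end

subsection \<open>Bounds on the SINR\<close>

lemma cnorm_squared: "(cnorm M x)\<^sup>2 = (\<Sum>j<M. (cmod (x j))\<^sup>2)"
  by (simp add: cnorm_def L2_set_def sum_nonneg)

lemma cdot_self: "cdot M x x = complex_of_real ((cnorm M x)\<^sup>2)"
  by (simp add: cdot_def cnorm_squared complex_norm_square mult.commute del: of_real_power)

text \<open>With detector \<open>h k\<close> the SINR is \<open>pu * X\<^sup>2 / D\<close> with
  \<open>X \<le> D\<close>. Cancelling \<open>X\<close> gives the upper bound;
  \<open>(X - D)\<^sup>2 \<ge> 0\<close> gives the lower one, which is linear in \<open>X\<close>
  and \<open>I\<close>, so its expectation involves no moments of \<open>1 / D\<close>.\<close>

lemma sinr_mrc_bounds: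
  fixes h :: "nat \<Rightarrow> nat \<Rightarrow> complex" and M K k :: nat
  assumes "0 \<le> pu"
    and S: "S = (\<Sum>i=1..K. \<beta> i - \<alpha>\<^sup>2 * (pp * (\<beta> i)\<^sup>2 / (1 + pp * \<beta> i)))" "0 \<le> S"
  defines "X \<equiv> (cnorm M (h k))\<^sup>2"
    and "I \<equiv> \<Sum>i\<in>{1..K} - {k}. (cmod (cdot M (h k) (h i)))\<^sup>2"
  shows "0 \<le> sinr M K \<alpha> pp \<beta> pu (h k) h k"
    and "sinr M K \<alpha> pp \<beta> pu (h k) h k \<le> pu * X"
    and "pu * X - (pu\<^sup>2 * S * X + pu\<^sup>2 * I) \<le> sinr M K \<alpha> pp \<beta> pu (h k) h k"
proof -
  define c where "c = pu * S + 1"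
  define D where "D = pu * I + X * c"
  have X: "0 \<le> X" and I: "0 \<le> I" and c: "1 \<le> c"
    using assms by (auto simp: sum_nonneg c_def)
  have eq: "sinr M K \<alpha> pp \<beta> pu (h k) h k = pu * X\<^sup>2 / D"
    unfolding sinr_def D_def c_def cdot_self X_def I_def S(1)[symmetric]
    by (simp add: norm_power)
  have D: "0 \<le> D" "X \<le> D" using X I c assms(1) mult_left_mono[OF c X]
      mult_nonneg_nonneg[OF assms(1) I] by (auto simp: D_def intro: add_increasing)
  show "0 \<le> sinr M K \<alpha> pp \<beta> pu (h k) h k" using D assms(1) by (simp add: eq)
  show "sinr M K \<alpha> pp \<beta> pu (h k) h k \<le> pu * X"
  proof (cases "D = 0")
    case False
    have "X * X \<le> X * D" using D X by (intro mult_left_mono)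
    then have "pu * (X * X) \<le> pu * (X * D)" using assms(1) by (rule mult_left_mono)
    moreover have "0 < D" using False D by simp
    ultimately show ?thesis
      unfolding eq by (simp only: pos_divide_le_eq power2_eq_square mult.assoc)
  qed (use X assms(1) in \<open>simp add: eq\<close>)
  show "pu * X - (pu\<^sup>2 * S * X + pu\<^sup>2 * I) \<le> sinr M K \<alpha> pp \<beta> pu (h k) h k"
  proof (cases "D = 0")
    \<comment> \<open>The degenerate case: \<open>X \<le> D\<close> forces \<open>X = 0\<close>, the
      fraction is \<open>0 / 0 = 0\<close>, and the left side is \<open>- pu\<^sup>2 * I\<close>,
      which is not positive.\<close>
    case True
    then have "X = 0" using D X by simp
    then show ?thesis using I by (simp add: eq True)
  next
    case False
    have "2 * X - D \<le> X\<^sup>2 / D"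
    proof -
      have "(2 * X - D) * D \<le> X\<^sup>2"
        using zero_le_power2[of "X - D"] by (simp add: power2_diff algebra_simps power2_eq_square)
      then show ?thesis using False D by (simp add: pos_le_divide_eq)
    qed
    then have "pu * (2 * X - D) \<le> pu * (X\<^sup>2 / D)" using assms(1) by (rule mult_left_mono)
    then show ?thesis unfolding eq D_def c_def by (simp add: algebra_simps power2_eq_square)
  qed
qed

text \<open>The derivative of \<open>ln (1 + s)\<close> is at most 1 for \<open>s \<ge> 0\<close>.
  Errors in the SINR therefore pass linearly to the rate.\<close>

lemma abs_log_diff_le:
  assumes "0 \<le> (s::real)" "0 \<le> t"
  shows "\<bar>log 2 (1 + s) - log 2 (1 + t)\<bar> \<le> \<bar>s - t\<bar> / ln 2"
proof -
  have le: "ln (1 + y) - ln (1 + x) \<le> y - x" if "0 \<le> x" "x \<le> y" for x y :: real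
  proof -
    have "ln (1 + y) - ln (1 + x) \<le> ((1 + y) - (1 + x)) / (1 + x)"
      using that by (intro ln_diff_le) auto
    also have "\<dots> \<le> y - x"
      using that mult_left_mono[of 1 "1 + x" "y - x"] by (subst pos_divide_le_eq) auto
    finally show ?thesis .
  qed
  have "\<bar>ln (1 + s) - ln (1 + t)\<bar> \<le> \<bar>s - t\<bar>"
    using le[of s t] le[of t s] assms ln_mono[of "1+s" "1+t"] ln_mono[of "1+t" "1+s"] by linarith
  then show ?thesis
    by (simp add: log_def diff_divide_distrib[symmetric] abs_divide divide_right_mono)
qed

subsection \<open>Moments of the observations and of the aged CSI\<close>

text \<open>After the triangle inequality, \<open>conv\<close> is used twice: the first use is
  squared and gives the factor 4, the second gives 2.\<close>

lemma norm_add_power4_le: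
  fixes x y :: "'b::real_normed_vector"
  shows "norm (x + y) ^ 4 \<le> 8 * (norm x ^ 4 + norm y ^ 4)"
proof -
  have conv: "(a + b)\<^sup>2 \<le> 2 * (a\<^sup>2 + b\<^sup>2)" for a b :: real
    by (smt (verit) power2_diff power2_sum zero_le_power2)
  have "norm (x + y) ^ 4 \<le> (norm x + norm y) ^ 4"
    by (intro power_mono norm_triangle_ineq) auto
  also have "\<dots> = ((norm x + norm y)\<^sup>2)\<^sup>2" by (simp flip: power_mult)
  also have "\<dots> \<le> (2 * ((norm x)\<^sup>2 + (norm y)\<^sup>2))\<^sup>2"
    by (intro power_mono conv) auto
  also have "\<dots> = 4 * ((norm x)\<^sup>2 + (norm y)\<^sup>2)\<^sup>2" by (simp only: power_mult_distrib) simp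
  also have "\<dots> \<le> 4 * (2 * (((norm x)\<^sup>2)\<^sup>2 + ((norm y)\<^sup>2)\<^sup>2))"
    by (intro mult_left_mono conv) auto
  finally show ?thesis by (simp flip: power_mult)
qed

text \<open>Left unevaluated: the error bounds need only a number that does not depend on
  \<open>M\<close> or on the power.\<close>

definition complex_normal_m4 :: "real \<Rightarrow> real" where
  "complex_normal_m4 v = (\<integral>z. cmod z ^ 4 \<partial>complex_normal v)"

context prob_space
begin

lemma complex_normal_variable:
  fixes X :: "'a \<Rightarrow> complex"
  assumes rv [measurable]: "random_variable borel X"
    and d: "distr M borel X = complex_normal v" and v: "0 < v"
  shows "integrable M X"
    and "expectation X = 0"
    and "integrable M (\<lambda>\<omega>. (cmod (X \<omega>))\<^sup>2)"
    and "expectation (\<lambda>\<omega>. (cmod (X \<omega>))\<^sup>2) = v"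
    and "integrable M (\<lambda>\<omega>. cmod (X \<omega>) ^ 4)"
    and "expectation (\<lambda>\<omega>. cmod (X \<omega>) ^ 4) = complex_normal_m4 v"
proof -
  note mom = complex_normal_moments[OF v, folded d]
  show "integrable M X" using mom(1) by (subst (asm) integrable_distr_eq) auto
  show "expectation X = 0" using mom(2) by (subst (asm) integral_distr) auto
  show i4: "integrable M (\<lambda>\<omega>. cmod (X \<omega>) ^ 4)"
    using mom(4) by (subst (asm) integrable_distr_eq) auto
  show "expectation (\<lambda>\<omega>. (cmod (X \<omega>))\<^sup>2) = v" using mom(3) by (subst (asm) integral_distr) auto
  show "integrable M (\<lambda>\<omega>. (cmod (X \<omega>))\<^sup>2)"
    by (rule square_integrable_imp_integrable) (use i4 in \<open>auto simp flip: power_mult\<close>)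
  show "expectation (\<lambda>\<omega>. cmod (X \<omega>) ^ 4) = complex_normal_m4 v"
    unfolding complex_normal_m4_def d[symmetric] by (subst integral_distr) auto
qed

end

context aged_uplink
begin

lemma random_source:
  assumes "k \<in> {1..K}" "j < M"
  shows "random_variable borel (\<lambda>\<omega>. g k \<omega> j)" "random_variable borel (\<lambda>\<omega>. b k \<omega> j)"
proof -
  have rv: "random_variable borel (source_var g b e i)" if "i \<in> UNIV \<times> {1..K} \<times> {..<M}" for i
    using indep that by (auto simp: indep_vars_def)
  show "random_variable borel (\<lambda>\<omega>. g k \<omega> j)" "random_variable borel (\<lambda>\<omega>. b k \<omega> j)"
    using rv[of "(Channel, k, j)"] rv[of "(Noise, k, j)"] assms by auto
qed

text \<open>Distinct pairs \<open>(k, j)\<close> draw on disjoint sources, one channel entry and one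
  noise entry each.\<close>

lemma indep_observations:
  "indep_vars (\<lambda>_. borel) (\<lambda>(k, j) \<omega>. observation pp g b k \<omega> j) ({1..K} \<times> {..<M})"
  by (rule indep_vars_blocks[OF indep, where L = "\<lambda>(k, j). {(Channel, k, j), (Noise, k, j)}"
        and F = "\<lambda>(k, j) f. f (Channel, k, j) + complex_of_real (1 / sqrt pp) * f (Noise, k, j)"])
     (auto simp: disjoint_family_on_def observation_def split_beta)

text \<open>Channel entry and scaled noise entry are independent and centred, so their variances
  add. For the fourth moment, what matters is the order \<open>1 / pp\<^sup>2\<close> as the pilot
  power vanishes, so the lossy constant 8 is harmless.\<close>

lemma observation_moments:
  assumes k: "k \<in> {1..K}" "j < M" and pos: "0 < \<beta> k" "0 < pp"
  defines "y \<equiv> \<lambda>\<omega>. observation pp g b k \<omega> j"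
  shows "random_variable borel y"
    and "integrable P y"
    and "expectation y = 0"
    and "integrable P (\<lambda>\<omega>. (cmod (y \<omega>))\<^sup>2)"
    and "expectation (\<lambda>\<omega>. (cmod (y \<omega>))\<^sup>2) = \<beta> k + 1 / pp"
    and "integrable P (\<lambda>\<omega>. cmod (y \<omega>) ^ 4)"
    and "expectation (\<lambda>\<omega>. cmod (y \<omega>) ^ 4) \<le> 8 * (complex_normal_m4 (\<beta> k) + complex_normal_m4 1 / pp\<^sup>2)"
proof -
  define s where "s = 1 / sqrt pp"
  have s: "s\<^sup>2 = 1 / pp" "s ^ 4 = 1 / pp\<^sup>2" "0 < s"
  proof -
    show "s\<^sup>2 = 1 / pp" "0 < s" using pos by (auto simp: s_def power_divide)
    then have "(s\<^sup>2)\<^sup>2 = (1 / pp)\<^sup>2" by simp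
    then show "s ^ 4 = 1 / pp\<^sup>2" by (simp add: power_divide flip: power_mult)
  qed
  note rv [measurable] = random_source[OF k]
  note G = complex_normal_variable[OF rv(1) channel[OF k] pos(1)]
  note B = complex_normal_variable[OF rv(2) noise[OF k] zero_less_one]
  have y: "y = (\<lambda>\<omega>. g k \<omega> j + complex_of_real s * b k \<omega> j)"
    by (simp add: y_def observation_def s_def)
  show rvy [measurable]: "random_variable borel y" unfolding y by measurable
  show "integrable P y" "expectation y = 0" unfolding y using G(1,2) B(1,2) by auto
  \<comment> \<open>The two summands become a family over \<open>{0, 1}\<close> so that the lemma on
    independent sums yields the variance.\<close>
  define W where "W = (\<lambda>n \<omega>. if n = (0::nat) then g k \<omega> j else complex_of_real s * b k \<omega> j)"
  have W: "indep_vars (\<lambda>_. borel) W {0, 1}"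
    by (rule indep_vars_blocks[OF indep, where L = "\<lambda>n. if n = (0::nat) then {(Channel, k, j)} else {(Noise, k, j)}"
        and F = "\<lambda>n f. if n = 0 then f (Channel, k, j) else complex_of_real s * f (Noise, k, j)"])
       (use k in \<open>auto simp: disjoint_family_on_def W_def\<close>)
  have Wsq: "integrable P (\<lambda>\<omega>. (cmod (W n \<omega>))\<^sup>2)" for n
    using G(3) B(3) by (cases "n = 0") (auto simp: W_def norm_mult power_mult_distrib)
  have W0: "expectation (W n) = 0" for n
    using G(2) B(2) by (cases "n = 0") (auto simp: W_def)
  note E = expectation_norm_sum_squared[OF _ W Wsq W0]
  have sumW: "(\<Sum>n\<in>{0, 1}. W n \<omega>) = y \<omega>" for \<omega> by (simp add: W_def y)
  show "integrable P (\<lambda>\<omega>. (cmod (y \<omega>))\<^sup>2)" using E(1) unfolding sumW by simp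
  show "expectation (\<lambda>\<omega>. (cmod (y \<omega>))\<^sup>2) = \<beta> k + 1 / pp"
    using E(2) G(4) B(4) unfolding sumW by (simp add: W_def norm_mult power_mult_distrib s(1))
  have i4: "integrable P (\<lambda>\<omega>. 8 * (cmod (g k \<omega> j) ^ 4 + s ^ 4 * cmod (b k \<omega> j) ^ 4))"
    using G(5) B(5) by auto
  have bd: "cmod (y \<omega>) ^ 4 \<le> 8 * (cmod (g k \<omega> j) ^ 4 + s ^ 4 * cmod (b k \<omega> j) ^ 4)" for \<omega>
    unfolding y using norm_add_power4_le[of "g k \<omega> j" "complex_of_real s * b k \<omega> j"]
    by (simp add: norm_mult power_mult_distrib)
  show y4: "integrable P (\<lambda>\<omega>. cmod (y \<omega>) ^ 4)"
    using i4 by (rule Bochner_Integration.integrable_bound) (auto intro!: AE_I2 order.trans[OF bd])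
  have "expectation (\<lambda>\<omega>. cmod (y \<omega>) ^ 4)
      \<le> expectation (\<lambda>\<omega>. 8 * (cmod (g k \<omega> j) ^ 4 + s ^ 4 * cmod (b k \<omega> j) ^ 4))"
    using y4 i4 bd by (rule integral_mono)
  also have "\<dots> = 8 * (complex_normal_m4 (\<beta> k) + complex_normal_m4 1 / pp\<^sup>2)"
    using G(5,6) B(5,6) by (simp add: s(2))
  finally show "expectation (\<lambda>\<omega>. cmod (y \<omega>) ^ 4) \<le> 8 * (complex_normal_m4 (\<beta> k) + complex_normal_m4 1 / pp\<^sup>2)" .
qed

text \<open>The squared norm is a sum of \<open>M\<close> independent terms whose second moments are
  the fourth moments of the entries. For fixed \<open>pp\<close> its fluctuation is of order
  \<open>sqrt M\<close> against a mean of order \<open>M\<close>.\<close>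

lemma observation_norm_concentration:
  assumes k: "k \<in> {1..K}" and pos: "0 < \<beta> k" "0 < pp"
  defines "X \<equiv> \<lambda>\<omega>. (cnorm M (observation pp g b k \<omega>))\<^sup>2"
  shows "integrable P X"
    and "expectation X = real M * (\<beta> k + 1 / pp)"
    and "expectation (\<lambda>\<omega>. \<bar>X \<omega> - real M * (\<beta> k + 1 / pp)\<bar>)
      \<le> sqrt (real M * (8 * (complex_normal_m4 (\<beta> k) + complex_normal_m4 1 / pp\<^sup>2)))"
proof -
  note mom = observation_moments[OF k _ pos]
  have ind: "indep_vars (\<lambda>_. borel) (\<lambda>j \<omega>. (cmod (observation pp g b k \<omega> j))\<^sup>2) {..<M}"
    by (rule indep_vars_blocks[OF indep_observations[of pp], where L = "\<lambda>j. {(k, j)}"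
          and F = "\<lambda>j f. (cmod (f (k, j)))\<^sup>2"])
       (use k in \<open>auto simp: disjoint_family_on_def\<close>)
  note D = expectation_abs_deviation_sum_le[OF _ ind, where c =
      "8 * (complex_normal_m4 (\<beta> k) + complex_normal_m4 1 / pp\<^sup>2)"]
  have eq: "X = (\<lambda>\<omega>. \<Sum>j<M. (cmod (observation pp g b k \<omega> j))\<^sup>2)"
    by (simp add: X_def cnorm_squared)
  show X: "integrable P X"
    unfolding eq using mom(4) by auto
  show "expectation X = real M * (\<beta> k + 1 / pp)"
    unfolding eq using mom(4,5) by (subst Bochner_Integration.integral_sum) auto
  show "expectation (\<lambda>\<omega>. \<bar>X \<omega> - real M * (\<beta> k + 1 / pp)\<bar>)
      \<le> sqrt (real M * (8 * (complex_normal_m4 (\<beta> k) + complex_normal_m4 1 / pp\<^sup>2)))"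
    using D(2) mom(5,6,7) unfolding eq by (simp flip: power_mult)
qed

text \<open>\<open>f\<close> may depend on the user, so that the conjugation in \<open>cdot\<close>
  can be applied to one user only.\<close>

lemma indep_observations_antenna:
  fixes f :: "nat \<Rightarrow> complex \<Rightarrow> 'c::topological_space"
  assumes "\<And>l. f l \<in> borel_measurable borel" "j < M"
  shows "indep_vars (\<lambda>_. borel) (\<lambda>l \<omega>. f l (observation pp g b l \<omega> j)) {1..K}"
  by (rule indep_vars_blocks[OF indep_observations[of pp], where L = "\<lambda>l. {(l, j)}"
        and F = "\<lambda>l h. f l (h (l, j))"])
     (use assms in \<open>auto simp: disjoint_family_on_def intro!: measurable_compose[OF _ assms(1)]\<close>)

text \<open>The inner product is a sum over antennas of independent products, each centred because
  the two users are independent. Its mean square is thus linear in \<open>M\<close>, while the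
  useful signal power grows quadratically.\<close>

lemma observation_cross:
  assumes k: "k \<in> {1..K}" "i \<in> {1..K}" "i \<noteq> k" and pos: "0 < \<beta> k" "0 < \<beta> i" "0 < pp"
  defines "Z \<equiv> \<lambda>\<omega>. (cmod (cdot M (observation pp g b k \<omega>) (observation pp g b i \<omega>)))\<^sup>2"
  shows "integrable P Z"
    and "expectation Z = real M * ((\<beta> k + 1 / pp) * (\<beta> i + 1 / pp))"
proof -
  define y where "y = observation pp g b"
  note mk = observation_moments[OF k(1) _ pos(1,3), folded y_def]
  note mi = observation_moments[OF k(2) _ pos(2,3), folded y_def]
  define W where "W = (\<lambda>j \<omega>. cnj (y k \<omega> j) * y i \<omega> j)"
  have W: "indep_vars (\<lambda>_. borel) W {..<M}"
    by (rule indep_vars_blocks[OF indep_observations[of pp], where L = "\<lambda>j. {(k, j), (i, j)}"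
          and F = "\<lambda>j f. cnj (f (k, j)) * f (i, j)"])
       (use k in \<open>auto simp: disjoint_family_on_def W_def y_def\<close>)
  have Wmean: "expectation (W j) = 0" if j: "j < M" for j
  proof -
    have "indep_vars (\<lambda>_. borel) (\<lambda>l \<omega>. if l = k then cnj (y l \<omega> j) else y l \<omega> j) {k, i}"
      unfolding y_def
      by (rule indep_vars_subset[OF indep_observations_antenna[where
            f = "\<lambda>l z. if l = k then cnj z else z", OF _ j]])
         (use k in \<open>auto simp: borel_measurable_cnj\<close>)
    moreover have "integrable P (\<lambda>\<omega>. if l = k then cnj (y l \<omega> j) else y l \<omega> j)" if "l \<in> {k, i}" for l
      using that mk(2)[OF j] mi(2)[OF j] by (cases "l = k") auto
    ultimately show ?thesis
      using indep_vars_lebesgue_integral[of "{k, i}" "\<lambda>l \<omega>. if l = k then cnj (y l \<omega> j) else y l \<omega> j"]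
        k(3) mk(2,3)[OF j] mi(2,3)[OF j] by (auto simp: W_def)
  qed
  have Wsq: "integrable P (\<lambda>\<omega>. (cmod (W j \<omega>))\<^sup>2) \<and>
      expectation (\<lambda>\<omega>. (cmod (W j \<omega>))\<^sup>2) = (\<beta> k + 1 / pp) * (\<beta> i + 1 / pp)" if j: "j < M" for j
  proof -
    \<comment> \<open>The squared moduli of the two users at one antenna are independent, so the
      second moment of \<open>W j\<close> is the product of the two variances.\<close>
    have "indep_vars (\<lambda>_. borel) (\<lambda>l \<omega>. (cmod (y l \<omega> j))\<^sup>2) {k, i}"
      unfolding y_def
      by (rule indep_vars_subset[OF indep_observations_antenna[where f = "\<lambda>l z. (cmod z)\<^sup>2", OF _ j]])
         (use k in auto)
    from indep_vars_lebesgue_integral[OF _ this] indep_vars_integrable[OF _ this] show ?thesis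
      using k(3) mk(4,5)[OF j] mi(4,5)[OF j] by (auto simp: W_def norm_mult power_mult_distrib)
  qed
  have eq: "Z = (\<lambda>\<omega>. (cmod (\<Sum>j<M. W j \<omega>))\<^sup>2)"
    by (simp add: Z_def W_def y_def cdot_def)
  note E = expectation_norm_sum_squared[OF _ W, folded eq]
  show "integrable P Z" by (rule E(1)) (use Wsq Wmean in auto)
  show "expectation Z = real M * ((\<beta> k + 1 / pp) * (\<beta> i + 1 / pp))"
    using E(2) Wsq Wmean by simp
qed

end

section \<open>Rescaling the observations to the aged CSI\<close>

definition csi_gain :: "real \<Rightarrow> real \<Rightarrow> real \<Rightarrow> real" where
  "csi_gain \<alpha> pp v = \<alpha> * (pp * v / (1 + pp * v))"

text \<open>The variance of one entry of the aged CSI; it is also the term subtracted from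
  \<open>\<beta> i\<close> in the denominator of \<open>sinr\<close>.\<close>

definition csi_var :: "real \<Rightarrow> real \<Rightarrow> real \<Rightarrow> real" where
  "csi_var \<alpha> pp v = \<alpha>\<^sup>2 * (pp * v\<^sup>2 / (1 + pp * v))"

lemma csi_var_eq:
  assumes "0 < pp" "0 < v"
  shows "(csi_gain \<alpha> pp v)\<^sup>2 * (v + 1 / pp) = csi_var \<alpha> pp v"
proof -
  have "1 + pp * v \<noteq> 0" using mult_pos_pos[OF assms] by linarith
  moreover have "v + 1 / pp = (1 + pp * v) / pp" using assms by (simp add: field_simps)
  ultimately show ?thesis using assms
    by (simp add: csi_gain_def csi_var_def power_mult_distrib power_divide)
       (simp add: power2_eq_square)
qed

text \<open>Estimation and aging only shrink the channel variance; this makes the total error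
  variance in the SINR nonnegative.\<close>

lemma csi_var_bounds:
  assumes "0 < pp" "0 < v" "\<bar>\<alpha>\<bar> \<le> 1"
  shows "0 \<le> csi_var \<alpha> pp v" "csi_var \<alpha> pp v \<le> v"
proof -
  have p: "0 < pp * v" using assms by simp
  show "0 \<le> csi_var \<alpha> pp v" using assms p by (simp add: csi_var_def)
  have le1: "pp * v / (1 + pp * v) \<le> 1" using p by (subst pos_divide_le_eq) auto
  have "csi_var \<alpha> pp v = \<alpha>\<^sup>2 * (v * (pp * v / (1 + pp * v)))"
    by (simp add: csi_var_def power2_eq_square)
  also have "\<dots> \<le> 1 * (v * 1)"
    using assms p by (intro mult_mono) (auto simp: abs_square_le_1 intro: le1)
  finally show "csi_var \<alpha> pp v \<le> v" by simp
qed

lemma aged_csi_eq: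
  "aged_csi \<alpha> pp \<beta> g b k \<omega> = (\<lambda>j. complex_of_real (csi_gain \<alpha> pp (\<beta> k)) * observation pp g b k \<omega> j)"
  by (simp add: aged_csi_def mmse_estimate_def csi_gain_def fun_eq_iff)

lemma cnorm_scale: "cnorm M (\<lambda>j. complex_of_real c * x j) = \<bar>c\<bar> * cnorm M x"
  by (simp add: cnorm_def norm_mult L2_set_right_distrib)

lemma cdot_scale:
  "cdot M (\<lambda>j. complex_of_real c * x j) (\<lambda>j. complex_of_real d * y j) = complex_of_real (c * d) * cdot M x y"
  by (simp add: cdot_def sum_distrib_left algebra_simps)

context aged_uplink
begin

text \<open>The aged CSI is a real multiple of the observation, so all moments are rescaled by
  squared gains, which \<open>csi_var_eq\<close> turns into variances.\<close>

lemma aged_csi_moments: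
  assumes k: "k \<in> {1..K}" and pos: "\<And>i. i \<in> {1..K} \<Longrightarrow> 0 < \<beta> i" "0 < pp"
  defines "h \<equiv> \<lambda>i \<omega>. aged_csi \<alpha> pp \<beta> g b i \<omega>"
  shows "integrable P (\<lambda>\<omega>. (cnorm M (h k \<omega>))\<^sup>2)"
    and "expectation (\<lambda>\<omega>. (cnorm M (h k \<omega>))\<^sup>2) = real M * csi_var \<alpha> pp (\<beta> k)"
    and "expectation (\<lambda>\<omega>. \<bar>(cnorm M (h k \<omega>))\<^sup>2 - real M * csi_var \<alpha> pp (\<beta> k)\<bar>)
      \<le> (csi_gain \<alpha> pp (\<beta> k))\<^sup>2 *
        sqrt (real M * (8 * (complex_normal_m4 (\<beta> k) + complex_normal_m4 1 / pp\<^sup>2)))"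
    and "integrable P (\<lambda>\<omega>. \<Sum>i\<in>{1..K} - {k}. (cmod (cdot M (h k \<omega>) (h i \<omega>)))\<^sup>2)"
    and "expectation (\<lambda>\<omega>. \<Sum>i\<in>{1..K} - {k}. (cmod (cdot M (h k \<omega>) (h i \<omega>)))\<^sup>2)
      = real M * csi_var \<alpha> pp (\<beta> k) * (\<Sum>i\<in>{1..K} - {k}. csi_var \<alpha> pp (\<beta> i))"
proof -
  define q where "q i = csi_gain \<alpha> pp (\<beta> i)" for i
  define y where "y = observation pp g b"
  note v = csi_var_eq[OF pos(2,1), of _ \<alpha>, folded q_def]
  have norm: "(cnorm M (h k \<omega>))\<^sup>2 = (q k)\<^sup>2 * (cnorm M (y k \<omega>))\<^sup>2" for \<omega>
    by (simp add: h_def y_def q_def aged_csi_eq cnorm_scale power_mult_distrib)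
  have cross: "(cmod (cdot M (h k \<omega>) (h i \<omega>)))\<^sup>2 = (q k)\<^sup>2 * (q i)\<^sup>2 * (cmod (cdot M (y k \<omega>) (y i \<omega>)))\<^sup>2" for i \<omega>
    by (simp add: h_def y_def q_def aged_csi_eq cdot_scale norm_mult abs_mult power_mult_distrib)
  note X = observation_norm_concentration[OF k pos(1)[OF k] pos(2), folded y_def]
  note Z = observation_cross[OF k _ _ pos(1)[OF k] pos(1) pos(2), folded y_def]
  have var: "real M * csi_var \<alpha> pp (\<beta> k) = (q k)\<^sup>2 * (real M * (\<beta> k + 1 / pp))"
    using v[OF k] by simp
  show "integrable P (\<lambda>\<omega>. (cnorm M (h k \<omega>))\<^sup>2)"
    unfolding norm using X(1) by auto
  show "expectation (\<lambda>\<omega>. (cnorm M (h k \<omega>))\<^sup>2) = real M * csi_var \<alpha> pp (\<beta> k)"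
    unfolding norm var using X(2) by simp
  show "expectation (\<lambda>\<omega>. \<bar>(cnorm M (h k \<omega>))\<^sup>2 - real M * csi_var \<alpha> pp (\<beta> k)\<bar>)
      \<le> (csi_gain \<alpha> pp (\<beta> k))\<^sup>2 *
        sqrt (real M * (8 * (complex_normal_m4 (\<beta> k) + complex_normal_m4 1 / pp\<^sup>2)))"
    unfolding norm var right_diff_distrib[symmetric] abs_mult q_def[symmetric]
    using X(3) by (simp add: mult_left_mono)
  show "integrable P (\<lambda>\<omega>. \<Sum>i\<in>{1..K} - {k}. (cmod (cdot M (h k \<omega>) (h i \<omega>)))\<^sup>2)"
    unfolding cross
    by (intro Bochner_Integration.integrable_sum Bochner_Integration.integrable_mult_right Z(1)) auto
  have "expectation (\<lambda>\<omega>. \<Sum>i\<in>{1..K} - {k}. (cmod (cdot M (h k \<omega>) (h i \<omega>)))\<^sup>2)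
      = (\<Sum>i\<in>{1..K} - {k}. (q k)\<^sup>2 * (q i)\<^sup>2 * (real M * ((\<beta> k + 1 / pp) * (\<beta> i + 1 / pp))))"
    unfolding cross using Z by (subst Bochner_Integration.integral_sum) auto
  also have "\<dots> = (\<Sum>i\<in>{1..K} - {k}. real M * csi_var \<alpha> pp (\<beta> k) * csi_var \<alpha> pp (\<beta> i))"
  proof (rule sum.cong[OF refl])
    fix i assume "i \<in> {1..K} - {k}"
    then have "csi_var \<alpha> pp (\<beta> i) = (q i)\<^sup>2 * (\<beta> i + 1 / pp)" using v by simp
    then show "(q k)\<^sup>2 * (q i)\<^sup>2 * (real M * ((\<beta> k + 1 / pp) * (\<beta> i + 1 / pp)))
        = real M * csi_var \<alpha> pp (\<beta> k) * csi_var \<alpha> pp (\<beta> i)"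
      using v[OF k, symmetric] by (simp only: mult_ac)
  qed
  finally show "expectation (\<lambda>\<omega>. \<Sum>i\<in>{1..K} - {k}. (cmod (cdot M (h k \<omega>) (h i \<omega>)))\<^sup>2)
      = real M * csi_var \<alpha> pp (\<beta> k) * (\<Sum>i\<in>{1..K} - {k}. csi_var \<alpha> pp (\<beta> i))"
    by (simp add: sum_distrib_left)
qed

text \<open>A bound for each fixed \<open>M\<close> and \<open>pu\<close>, so that one limit
  argument can serve both power laws. Its terms come, in order, from the fluctuation of the CSI
  energy, the estimation error and the interference.\<close>

lemma rate_mrc_error:
  fixes \<tau> :: nat
  assumes k: "k \<in> {1..K}" and \<alpha>: "\<bar>\<alpha>\<bar> \<le> 1" and \<beta>: "\<And>i. i \<in> {1..K} \<Longrightarrow> 0 < \<beta> i"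
    and pu: "0 < pu" and \<tau>: "0 < \<tau>"
  defines "pp \<equiv> real \<tau> * pu"
  defines "\<sigma> \<equiv> \<lambda>i. csi_var \<alpha> pp (\<beta> i)"
  shows "\<bar>rate_mrc P M K \<tau> \<alpha> \<beta> g b pu k - log 2 (1 + pu * (real M * \<sigma> k))\<bar> \<le>
    (pu * ((csi_gain \<alpha> pp (\<beta> k))\<^sup>2 *
        sqrt (real M * (8 * (complex_normal_m4 (\<beta> k) + complex_normal_m4 1 / pp\<^sup>2)))) +
     (pu\<^sup>2 * (\<Sum>i=1..K. \<beta> i - \<sigma> i) * (real M * \<sigma> k) +
      pu\<^sup>2 * (real M * \<sigma> k * (\<Sum>i\<in>{1..K} - {k}. \<sigma> i)))) / ln 2"
proof -
  have pp: "0 < pp" using pu \<tau> by (simp add: pp_def)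
  define h where "h = (\<lambda>i \<omega>. aged_csi \<alpha> pp \<beta> g b i \<omega>)"
  note mom = aged_csi_moments[OF k \<beta> pp, folded h_def]
  define X where "X \<omega> = (cnorm M (h k \<omega>))\<^sup>2" for \<omega>
  define I where "I \<omega> = (\<Sum>i\<in>{1..K} - {k}. (cmod (cdot M (h k \<omega>) (h i \<omega>)))\<^sup>2)" for \<omega>
  define S where "S = (\<Sum>i=1..K. \<beta> i - \<sigma> i)"
  define m where "m = real M * \<sigma> k"
  define s where "s = (\<lambda>\<omega>. sinr M K \<alpha> pp \<beta> pu (h k \<omega>) (\<lambda>i. h i \<omega>) k)"
  have m_eq: "m = real M * csi_var \<alpha> pp (\<beta> k)" by (simp add: m_def \<sigma>_def)
  note mom' = mom[folded X_def I_def m_eq]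
  have Smean: "S = (\<Sum>i=1..K. \<beta> i - \<alpha>\<^sup>2 * (pp * (\<beta> i)\<^sup>2 / (1 + pp * \<beta> i)))"
    by (simp add: S_def \<sigma>_def csi_var_def)
  have S: "0 \<le> S"
    unfolding S_def \<sigma>_def by (intro sum_nonneg) (use csi_var_bounds[OF pp \<beta> \<alpha>] in auto)
  have m: "0 \<le> m" using csi_var_bounds[OF pp \<beta>[OF k] \<alpha>] by (simp add: m_def \<sigma>_def)
  have s: "0 \<le> s \<omega>" "s \<omega> \<le> pu * X \<omega>" "pu * X \<omega> - (pu\<^sup>2 * S * X \<omega> + pu\<^sup>2 * I \<omega>) \<le> s \<omega>" for \<omega>
    using sinr_mrc_bounds[OF less_imp_le[OF pu] Smean S, of M "\<lambda>i. h i \<omega>" k]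
    by (auto simp: s_def X_def I_def)
  have XI: "0 \<le> X \<omega>" "0 \<le> I \<omega>" for \<omega> by (auto simp: X_def I_def sum_nonneg)
  \<comment> \<open>The fluctuation of \<open>X\<close> plus the gap between the two SINR bounds;
    the moments above bound its mean.\<close>
  define B where "B = (\<lambda>\<omega>. pu * \<bar>X \<omega> - m\<bar> + (pu\<^sup>2 * S * X \<omega> + pu\<^sup>2 * I \<omega>))"
  have dev: "\<bar>s \<omega> - pu * m\<bar> \<le> B \<omega>" for \<omega>
  proof -
    have "\<bar>s \<omega> - pu * m\<bar> \<le> \<bar>pu * X \<omega> - pu * m\<bar> + \<bar>s \<omega> - pu * X \<omega>\<bar>" by linarith
    also have "\<bar>pu * X \<omega> - pu * m\<bar> = pu * \<bar>X \<omega> - m\<bar>"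
      using pu by (simp add: abs_mult flip: right_diff_distrib)
    also have "\<bar>s \<omega> - pu * X \<omega>\<bar> \<le> pu\<^sup>2 * S * X \<omega> + pu\<^sup>2 * I \<omega>" using s[of \<omega>] by linarith
    finally show ?thesis by (simp add: B_def)
  qed
  have rvX [measurable]: "random_variable borel X" using mom'(1) by auto
  have rvI [measurable]: "random_variable borel I" using mom'(4) by auto
  have s_eq: "s = (\<lambda>\<omega>. pu * (X \<omega>)\<^sup>2 / (pu * I \<omega> + X \<omega> * (pu * S + 1)))"
    unfolding s_def sinr_def cdot_self Smean X_def I_def by (simp add: norm_power)
  have rvs [measurable]: "random_variable borel s" unfolding s_eq by measurable
  define L where "L = (\<lambda>\<omega>. log 2 (1 + s \<omega>))"
  have Ldev: "\<bar>L \<omega> - log 2 (1 + pu * m)\<bar> \<le> B \<omega> / ln 2" for \<omega>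
  proof -
    have "\<bar>L \<omega> - log 2 (1 + pu * m)\<bar> \<le> \<bar>s \<omega> - pu * m\<bar> / ln 2"
      unfolding L_def using s(1) pu m by (intro abs_log_diff_le) auto
    also have "\<dots> \<le> B \<omega> / ln 2" using dev by (intro divide_right_mono) auto
    finally show ?thesis .
  qed
  have Bint: "integrable P B" unfolding B_def using mom'(1,4) by auto
  \<comment> \<open>Integrability matters: otherwise the integral in \<open>rate\<close> would
    default to 0. Domination by \<open>B\<close> supplies it and lets the constant be moved inside
    the expectation.\<close>
  have Dint: "integrable P (\<lambda>\<omega>. L \<omega> - log 2 (1 + pu * m))"
  proof (rule Bochner_Integration.integrable_bound)
    show "integrable P (\<lambda>\<omega>. B \<omega> / ln 2)" using Bint by auto
    show "(\<lambda>\<omega>. L \<omega> - log 2 (1 + pu * m)) \<in> borel_measurable P" unfolding L_def by measurable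
  qed (auto intro!: AE_I2 order.trans[OF Ldev] divide_right_mono)
  then have "integrable P (\<lambda>\<omega>. (L \<omega> - log 2 (1 + pu * m)) + log 2 (1 + pu * m))"
    by (rule Bochner_Integration.integrable_add) auto
  then have Lint: "integrable P L" by simp
  have "rate_mrc P M K \<tau> \<alpha> \<beta> g b pu k = expectation L"
    by (simp add: rate_mrc_def rate_def pilot_power_def Let_def L_def s_def h_def pp_def)
  then have "\<bar>rate_mrc P M K \<tau> \<alpha> \<beta> g b pu k - log 2 (1 + pu * m)\<bar>
      = \<bar>expectation (\<lambda>\<omega>. L \<omega> - log 2 (1 + pu * m))\<bar>"
    using Lint by (simp add: prob_space)
  also have "\<dots> \<le> expectation (\<lambda>\<omega>. \<bar>L \<omega> - log 2 (1 + pu * m)\<bar>)"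
    by (rule integral_abs_bound)
  also have "\<dots> \<le> expectation (\<lambda>\<omega>. B \<omega> / ln 2)"
    using Dint Bint Ldev by (intro integral_mono) auto
  also have "\<dots> = (pu * expectation (\<lambda>\<omega>. \<bar>X \<omega> - m\<bar>) + (pu\<^sup>2 * S * m + pu\<^sup>2 * (m * (\<Sum>i\<in>{1..K} - {k}. \<sigma> i)))) / ln 2"
    unfolding B_def using mom'(1,2,4,5) by (simp add: \<sigma>_def)
  also have "\<dots> \<le> (pu * ((csi_gain \<alpha> pp (\<beta> k))\<^sup>2 *
        sqrt (real M * (8 * (complex_normal_m4 (\<beta> k) + complex_normal_m4 1 / pp\<^sup>2)))) +
     (pu\<^sup>2 * S * m + pu\<^sup>2 * (m * (\<Sum>i\<in>{1..K} - {k}. \<sigma> i)))) / ln 2"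
    using mom'(3) pu by (intro divide_right_mono add_right_mono mult_left_mono) auto
  finally show ?thesis by (simp only: S_def m_def)
qed

end

subsection \<open>The limit of the rate\<close>

text \<open>Two factors of the power meet the factor \<open>M\<close>: one is the transmit power,
  the other enters through the CSI variance, which is asymptotically proportional to the pilot
  power. Hence the limit \<open>E\<close> of \<open>(p M)\<^sup>2 * real M\<close> decides, and the
  critical decay is \<open>1 / sqrt M\<close>.\<close>

lemma tendsto_rate_mrc:
  fixes P :: "nat \<Rightarrow> 'a measure"
    and g b e g_next :: "nat \<Rightarrow> nat \<Rightarrow> 'a \<Rightarrow> nat \<Rightarrow> complex"
    and \<tau> :: nat
  assumes k: "k \<in> {1..K}" and \<alpha>: "\<bar>\<alpha>\<bar> \<le> 1" and \<beta>: "\<And>i. i \<in> {1..K} \<Longrightarrow> 0 < \<beta> i"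
    and \<tau>: "0 < \<tau>"
    and model: "\<And>M. K \<le> M \<Longrightarrow> aged_uplink (P M) M K \<beta> \<alpha> (g M) (b M) (e M) (g_next M)"
    and pos: "\<And>M. 0 < M \<Longrightarrow> 0 < p M"
    and lim0: "p \<longlonglongrightarrow> 0" and lim: "(\<lambda>M. (p M)\<^sup>2 * real M) \<longlonglongrightarrow> E"
  shows "(\<lambda>M. rate_mrc (P M) M K \<tau> \<alpha> \<beta> (g M) (b M) (p M) k) \<longlonglongrightarrow> log 2 (1 + \<alpha>\<^sup>2 * real \<tau> * E * (\<beta> k)\<^sup>2)"
proof -
  define pp where "pp M = real \<tau> * p M" for M
  define \<sigma> where "\<sigma> = (\<lambda>M i. csi_var \<alpha> (pp M) (\<beta> i))"
  \<comment> \<open>The CSI variance with one factor of the power taken out; unlike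
    \<open>\<sigma>\<close> it keeps a limit that need not vanish.\<close>
  define \<rho> where "\<rho> = (\<lambda>M i. \<alpha>\<^sup>2 * real \<tau> * ((\<beta> i)\<^sup>2 / (1 + pp M * \<beta> i)))"
  define F where "F = 8 * complex_normal_m4 (\<beta> k)"
  define N where "N = 8 * complex_normal_m4 1"
  have pp0: "pp \<longlonglongrightarrow> 0" unfolding pp_def by (rule tendsto_eq_intros refl lim0)+ simp
  have \<sigma>\<rho>: "\<sigma> M i = p M * \<rho> M i" for M i
    by (simp add: \<sigma>_def \<rho>_def csi_var_def pp_def)
  have \<rho>lim: "(\<lambda>M. \<rho> M i) \<longlonglongrightarrow> \<alpha>\<^sup>2 * real \<tau> * (\<beta> i)\<^sup>2" for i
    unfolding \<rho>_def by (rule tendsto_eq_intros refl pp0 | simp)+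
  have \<sigma>lim: "(\<lambda>M. \<sigma> M i) \<longlonglongrightarrow> 0" for i
    unfolding \<sigma>\<rho> by (rule tendsto_eq_intros refl lim0 \<rho>lim | simp)+
  define m where "m = (\<lambda>M. p M * (real M * \<sigma> M k))"
  have m_eq: "m = (\<lambda>M. ((p M)\<^sup>2 * real M) * \<rho> M k)"
    by (simp add: m_def \<sigma>\<rho> power2_eq_square mult_ac fun_eq_iff)
  have mlim: "m \<longlonglongrightarrow> E * (\<alpha>\<^sup>2 * real \<tau> * (\<beta> k)\<^sup>2)"
    unfolding m_eq by (intro tendsto_mult lim \<rho>lim)
  have E: "0 \<le> E" using lim by (rule LIMSEQ_le_const) auto
  define T where "T = (\<lambda>M. p M * ((csi_gain \<alpha> (pp M) (\<beta> k))\<^sup>2 *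
        sqrt (real M * (8 * (complex_normal_m4 (\<beta> k) + complex_normal_m4 1 / (pp M)\<^sup>2)))))"
  define R where "R = (\<lambda>M. (p M)\<^sup>2 * (\<Sum>i=1..K. \<beta> i - \<sigma> M i) * (real M * \<sigma> M k) +
      (p M)\<^sup>2 * (real M * \<sigma> M k * (\<Sum>i\<in>{1..K} - {k}. \<sigma> M i)))"
  \<comment> \<open>The mean SINR term \<open>m\<close> converges and the sums of variances stay
    bounded, so the remaining factor \<open>p M\<close> sends \<open>R\<close> to 0.\<close>
  have R_eq: "R = (\<lambda>M. m M * p M * ((\<Sum>i=1..K. \<beta> i - \<sigma> M i) + (\<Sum>i\<in>{1..K} - {k}. \<sigma> M i)))"
    by (simp add: R_def m_def power2_eq_square algebra_simps fun_eq_iff)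
  have Rlim: "R \<longlonglongrightarrow> 0"
    unfolding R_eq by (rule tendsto_eq_intros refl mlim lim0 \<sigma>lim | simp)+
  \<comment> \<open>The squared gain contributes \<open>(pp M)\<^sup>2\<close> and the root
    contributes \<open>1 / pp M\<close>, so one factor \<open>pp M\<close> survives. Writing
    \<open>sqrt M\<close> as \<open>M / sqrt M\<close> then exposes the convergent product
    \<open>(p M)\<^sup>2 * real M\<close> and a vanishing factor. Positivity of \<open>M\<close> is
    what makes \<open>pp M\<close> cancellable.\<close>
  have T_eq: "T M = ((p M)\<^sup>2 * real M) * (1 / sqrt (real M)) *
      (real \<tau> * (\<alpha> * (\<beta> k / (1 + pp M * \<beta> k)))\<^sup>2 * sqrt (F * (pp M)\<^sup>2 + N))" if M: "0 < M" for M
  proof -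
    define A where "A = (\<alpha> * (\<beta> k / (1 + pp M * \<beta> k)))\<^sup>2"
    define B where "B = sqrt (F * (pp M)\<^sup>2 + N)"
    have ppM: "0 < pp M" using pos[OF M] \<tau> by (simp add: pp_def)
    have "8 * (complex_normal_m4 (\<beta> k) + complex_normal_m4 1 / (pp M)\<^sup>2) = (F * (pp M)\<^sup>2 + N) / (pp M)\<^sup>2"
      using ppM by (simp add: F_def N_def field_simps)
    then have "sqrt (real M * (8 * (complex_normal_m4 (\<beta> k) + complex_normal_m4 1 / (pp M)\<^sup>2)))
        = sqrt (real M) * (sqrt (F * (pp M)\<^sup>2 + N) / pp M)"
      using ppM by (simp only: real_sqrt_mult real_sqrt_divide real_sqrt_abs abs_of_pos)
    moreover have "csi_gain \<alpha> (pp M) (\<beta> k) = pp M * (\<alpha> * (\<beta> k / (1 + pp M * \<beta> k)))"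
      by (simp add: csi_gain_def)
    ultimately have "T M = p M * (pp M * (\<alpha> * (\<beta> k / (1 + pp M * \<beta> k)))\<^sup>2 * sqrt (real M) * sqrt (F * (pp M)\<^sup>2 + N))"
      unfolding T_def using ppM by (simp only: power_mult_distrib) (simp add: power2_eq_square)
    moreover have "sqrt (real M) = real M * (1 / sqrt (real M))"
      by (simp add: real_div_sqrt)
    ultimately have "T M = p M * (pp M * A * (real M * (1 / sqrt (real M))) * B)"
      by (simp only: A_def B_def)
    then have "T M = ((p M)\<^sup>2 * real M) * (1 / sqrt (real M)) * (real \<tau> * A * B)"
      unfolding pp_def by (simp only: power2_eq_square mult_ac)
    then show ?thesis by (simp only: A_def B_def)
  qed
  have sq0: "(\<lambda>M. 1 / sqrt (real M)) \<longlonglongrightarrow> 0"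
    by real_asymp
  have "(\<lambda>M. ((p M)\<^sup>2 * real M) * (1 / sqrt (real M)) *
      (real \<tau> * (\<alpha> * (\<beta> k / (1 + pp M * \<beta> k)))\<^sup>2 * sqrt (F * (pp M)\<^sup>2 + N))) \<longlonglongrightarrow> 0"
    by (rule tendsto_eq_intros refl lim sq0 pp0 | simp)+
  then have Tlim: "T \<longlonglongrightarrow> 0"
    by (rule Lim_transform_eventually) (use eventually_gt_at_top[of 0] in \<open>eventually_elim, simp add: T_eq\<close>)
  have "(\<lambda>M. rate_mrc (P M) M K \<tau> \<alpha> \<beta> (g M) (b M) (p M) k - log 2 (1 + m M)) \<longlonglongrightarrow> 0"
  proof (rule tendsto_rabs_zero_cancel, rule tendsto_sandwich[where f = "\<lambda>_. 0"])
    \<comment> \<open>Since some user exists, \<open>K \<le> M\<close> also gives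
      \<open>0 < M\<close>, where the power is positive.\<close>
    have "K > 0" using k by simp
    show "eventually (\<lambda>M. \<bar>rate_mrc (P M) M K \<tau> \<alpha> \<beta> (g M) (b M) (p M) k - log 2 (1 + m M)\<bar>
        \<le> (T M + R M) / ln 2) sequentially"
      using eventually_ge_at_top[of K]
    proof eventually_elim
      case (elim M)
      interpret aged_uplink "P M" M K \<beta> \<alpha> "g M" "b M" "e M" "g_next M" by (rule model) fact
      show ?case
        using rate_mrc_error[OF k \<alpha> \<beta> pos \<tau>, of M] elim \<open>K > 0\<close>
        by (simp add: T_def R_def m_def \<sigma>_def pp_def)
    qed
    show "(\<lambda>M. (T M + R M) / ln 2) \<longlonglongrightarrow> 0"
      by (rule tendsto_eq_intros refl Tlim Rlim | simp)+
  qed auto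
  moreover have "(\<lambda>M. log 2 (1 + m M)) \<longlonglongrightarrow> log 2 (1 + E * (\<alpha>\<^sup>2 * real \<tau> * (\<beta> k)\<^sup>2))"
  proof (intro tendsto_intros mlim)
    have "0 \<le> E * (\<alpha>\<^sup>2 * real \<tau> * (\<beta> k)\<^sup>2)" using E by simp
    then show "1 + E * (\<alpha>\<^sup>2 * real \<tau> * (\<beta> k)\<^sup>2) \<noteq> 0" by linarith
  qed auto
  ultimately have "(\<lambda>M. (rate_mrc (P M) M K \<tau> \<alpha> \<beta> (g M) (b M) (p M) k - log 2 (1 + m M)) + log 2 (1 + m M))
      \<longlonglongrightarrow> 0 + log 2 (1 + E * (\<alpha>\<^sup>2 * real \<tau> * (\<beta> k)\<^sup>2))"
    by (rule tendsto_add)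
  then show ?thesis by (simp add: mult_ac)
qed

section \<open>The two power scaling laws\<close>

theorem corollary1:
  fixes P :: "nat \<Rightarrow> 'a measure"
    and g b e g_next :: "nat \<Rightarrow> nat \<Rightarrow> 'a \<Rightarrow> nat \<Rightarrow> complex"
    and K \<tau> :: nat
    and \<alpha> E\<^sub>u :: real
    and \<beta> :: "nat \<Rightarrow> real"
  assumes "K \<le> \<tau>"
    and "0 \<le> \<bar>\<alpha>\<bar>" "\<bar>\<alpha>\<bar> \<le> 1"
    and "\<And>k. k \<in> {1..K} \<Longrightarrow> 0 < \<beta> k"
    and "0 < E\<^sub>u"
    and "\<And>M. K \<le> M \<Longrightarrow> aged_uplink (P M) M K \<beta> \<alpha> (g M) (b M) (e M) (g_next M)"
  shows "\<forall>k\<in>{1..K}.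
      ((\<lambda>M. rate_mrc (P M) M K \<tau> \<alpha> \<beta> (g M) (b M) (E\<^sub>u / sqrt (real M)) k)
         \<longlonglongrightarrow> log 2 (1 + \<alpha>\<^sup>2 * real \<tau> * E\<^sub>u\<^sup>2 * (\<beta> k)\<^sup>2)) \<and>
      (\<forall>\<gamma>>1/2. (\<lambda>M. rate_mrc (P M) M K \<tau> \<alpha> \<beta> (g M) (b M) (E\<^sub>u / real M powr \<gamma>) k) \<longlonglongrightarrow> 0)"
proof (intro ballI conjI allI impI)
  fix k assume k: "k \<in> {1..K}"
  then have \<tau>: "0 < \<tau>" using assms(1) by simp
  note lim = tendsto_rate_mrc[OF k assms(3,4) \<tau> assms(6)]
  show "(\<lambda>M. rate_mrc (P M) M K \<tau> \<alpha> \<beta> (g M) (b M) (E\<^sub>u / sqrt (real M)) k)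
      \<longlonglongrightarrow> log 2 (1 + \<alpha>\<^sup>2 * real \<tau> * E\<^sub>u\<^sup>2 * (\<beta> k)\<^sup>2)"
  proof (rule lim)
    show "(\<lambda>M. E\<^sub>u / sqrt (real M)) \<longlonglongrightarrow> 0" by real_asymp
    \<comment> \<open>The sequence is constant except at \<open>M = 0\<close>, where it is
      0.\<close>
    show "(\<lambda>M. (E\<^sub>u / sqrt (real M))\<^sup>2 * real M) \<longlonglongrightarrow> E\<^sub>u\<^sup>2"
      by (rule tendsto_eventually)
         (use eventually_gt_at_top[of 0] in \<open>eventually_elim, simp add: power_divide\<close>)
  qed (use assms(5) in auto)
  fix \<gamma> :: real assume \<gamma>: "1/2 < \<gamma>"
  have "(\<lambda>M. rate_mrc (P M) M K \<tau> \<alpha> \<beta> (g M) (b M) (E\<^sub>u / real M powr \<gamma>) k)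
      \<longlonglongrightarrow> log 2 (1 + \<alpha>\<^sup>2 * real \<tau> * 0 * (\<beta> k)\<^sup>2)"
  proof (rule lim)
    show "(\<lambda>M. E\<^sub>u / real M powr \<gamma>) \<longlonglongrightarrow> 0" using \<gamma> by real_asymp
    show "(\<lambda>M. (E\<^sub>u / real M powr \<gamma>)\<^sup>2 * real M) \<longlonglongrightarrow> 0"
    proof (rule Lim_transform_eventually)
      \<comment> \<open>The exponent \<open>1 - 2 * \<gamma>\<close> is negative exactly because
        \<open>\<gamma>\<close> exceeds \<open>1/2\<close>.\<close>
      show "(\<lambda>M. E\<^sub>u\<^sup>2 * real M powr (1 - 2 * \<gamma>)) \<longlonglongrightarrow> 0" using \<gamma> by real_asymp
      show "\<forall>\<^sub>F M in sequentially. E\<^sub>u\<^sup>2 * real M powr (1 - 2 * \<gamma>) = (E\<^sub>u / real M powr \<gamma>)\<^sup>2 * real M"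
        using eventually_gt_at_top[of 0]
        by eventually_elim (simp add: powr_diff power_divide power2_eq_square flip: powr_add)
    qed
  qed (use assms(5) in auto)
  then show "(\<lambda>M. rate_mrc (P M) M K \<tau> \<alpha> \<beta> (g M) (b M) (E\<^sub>u / real M powr \<gamma>) k) \<longlonglongrightarrow> 0"
    by simp
qed

end
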